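(* Let $k$ be a rig and let $\mathbf{A}$ and $\mathbf{A}'$ be finite categories with fine Möbius inversion over $k$. Suppose that $\mathbf{A}$ and $\mathbf{A}'$ have the same underlying directed graph. Then $$\sum_{f\in\mathbf{A}_1}\mu_{\mathbf{A}}(f)=\sum_{f\in\mathbf{A}'_1}\mu_{\mathbf{A}'}(f),$$ where $\mu_{\mathbf{A}}$ and $\mu_{\mathbf{A}'}$ are the fine Möbius functions and $\mathbf{A}_1$, $\mathbf{A}'_1$ are the sets of all maps.
   Context: A rig is a set with a commutative monoid structure $(+,0)$ and a commutative monoid structure $(\cdot,1)$, the latter distributing over the former (including $0\cdot x=0$). A category is finite if it has only finitely many objects and maps. For a finite category $\mathbf{A}$ with set of maps $\mathbf{A}_1$, the fine incidence algebra $k\mathbf{A}$ is the set of functions $\mathbf{A}_1\to k$ with pointwise $k$-module structure and product $(\alpha*\beta)(f)=\sum_{hg=f}\alpha(g)\beta(h)$; the unit $\delta$ is $1$ on identities and $0$ on other maps. The fine zeta function $\zeta_{\mathbf{A}}\in k\mathbf{A}$ is $\zeta_{\mathbf{A}}(f)=1$ for all $f$. $\mathbf{A}$ has fine Möbius inversion over $k$ if $\zeta_{\mathbf{A}}$ has a multiplicative inverse in $k\mathbf{A}$; this inverse $\mu_{\mathbf{A}}$ is the fine Möbius function. The underlying directed graph of a category consists of its objects (vertices) and maps (edges) with their sources and targets, forgetting composition and identities. *)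

theory Defs
  imports "Graph_Theory.Digraph" "HOL-Algebra.Module" "HOL-Library.FuncSet"
begin

text \<open>
  A category structure is a directed graph (objects, maps, source, target) with identities and
  composition.  Only the values of \<open>tail\<close>, \<open>head\<close> and \<open>cat_comp\<close> on maps and those of \<open>cat_id\<close> on
  objects are meaningful, and \<open>cat_comp A h g\<close> (\<open>h\<close> after \<open>g\<close>) only if \<open>head A g = tail A h\<close>.
\<close>

record ('o, 'm) cat = "('o, 'm) pre_digraph" +
  cat_id :: "'o \<Rightarrow> 'm"
  cat_comp :: "'m \<Rightarrow> 'm \<Rightarrow> 'm"

text \<open>
  Source and target are restricted to the maps, so that equality of underlying directed graphs
  does not depend on the irrelevant values of \<open>tail\<close> and \<open>head\<close> elsewhere.
\<close>

definition underlying_digraph :: "('o, 'm) cat \<Rightarrow> ('o, 'm) pre_digraph" where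
  "underlying_digraph A =
     \<lparr>verts = verts A, arcs = arcs A,
      tail = restrict (tail A) (arcs A), head = restrict (head A) (arcs A)\<rparr>"

locale category =
  fixes A :: "('o, 'm) cat"
  assumes wf_underlying_digraph: "wf_digraph (underlying_digraph A)"
    and id_in_arcs: "a \<in> verts A \<Longrightarrow> cat_id A a \<in> arcs A"
    and tail_id: "a \<in> verts A \<Longrightarrow> tail A (cat_id A a) = a"
    and head_id: "a \<in> verts A \<Longrightarrow> head A (cat_id A a) = a"
    and comp_in_arcs: "\<lbrakk>g \<in> arcs A; h \<in> arcs A; head A g = tail A h\<rbrakk> \<Longrightarrow> cat_comp A h g \<in> arcs A"
    and tail_comp: "\<lbrakk>g \<in> arcs A; h \<in> arcs A; head A g = tail A h\<rbrakk>
      \<Longrightarrow> tail A (cat_comp A h g) = tail A g"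
    and head_comp: "\<lbrakk>g \<in> arcs A; h \<in> arcs A; head A g = tail A h\<rbrakk>
      \<Longrightarrow> head A (cat_comp A h g) = head A h"
    and comp_id_right: "f \<in> arcs A \<Longrightarrow> cat_comp A f (cat_id A (tail A f)) = f"
    and comp_id_left: "f \<in> arcs A \<Longrightarrow> cat_comp A (cat_id A (head A f)) f = f"
    and comp_assoc: "\<lbrakk>f \<in> arcs A; g \<in> arcs A; h \<in> arcs A;
        head A f = tail A g; head A g = tail A h\<rbrakk>
      \<Longrightarrow> cat_comp A h (cat_comp A g f) = cat_comp A (cat_comp A h g) f"

locale finite_category = category A for A :: "('o, 'm) cat" +
  assumes finite_objects: "finite (verts A)"
    and finite_maps: "finite (arcs A)"

definition factorizations :: "('o, 'm) cat \<Rightarrow> 'm \<Rightarrow> ('m \<times> 'm) set" where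
  "factorizations A f =
     {(g, h). g \<in> arcs A \<and> h \<in> arcs A \<and> head A g = tail A h \<and> cat_comp A h g = f}"

text \<open>
  The sort \<open>{comm_semiring_0, comm_monoid_mult}\<close> is that of (commutative) rigs.  Unlike in
  \<open>comm_semiring_1\<close>, the equation \<open>0 = 1\<close> is not excluded.  Functions on the set of maps are
  represented by extensional functions.
\<close>

definition fine_incidence_algebra ::
    "('o, 'm) cat \<Rightarrow> ('k::{comm_semiring_0, comm_monoid_mult}, 'm \<Rightarrow> 'k) module" where
  "fine_incidence_algebra A =
     \<lparr>carrier = arcs A \<rightarrow>\<^sub>E UNIV,
      mult = (\<lambda>\<alpha> \<beta>. \<lambda>f\<in>arcs A. \<Sum>(g, h)\<in>factorizations A f. \<alpha> g * \<beta> h),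
      one = (\<lambda>f\<in>arcs A. if f \<in> cat_id A ` verts A then 1 else 0),
      zero = (\<lambda>f\<in>arcs A. 0),
      add = (\<lambda>\<alpha> \<beta>. \<lambda>f\<in>arcs A. \<alpha> f + \<beta> f),
      smult = (\<lambda>c \<alpha>. \<lambda>f\<in>arcs A. c * \<alpha> f)\<rparr>"

definition fine_zeta :: "('o, 'm) cat \<Rightarrow> 'm \<Rightarrow> 'k::{comm_semiring_0, comm_monoid_mult}" where
  "fine_zeta A = (\<lambda>f\<in>arcs A. 1)"

definition has_fine_moebius_inversion ::
    "'k::{comm_semiring_0, comm_monoid_mult} itself \<Rightarrow> ('o, 'm) cat \<Rightarrow> bool" where
  "has_fine_moebius_inversion _ A \<longleftrightarrow>
     (fine_zeta A :: 'm \<Rightarrow> 'k) \<in> Units (fine_incidence_algebra A)"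

definition fine_moebius :: "('o, 'm) cat \<Rightarrow> 'm \<Rightarrow> 'k::{comm_semiring_0, comm_monoid_mult}" where
  "fine_moebius A = inv\<^bsub>fine_incidence_algebra A\<^esub> (fine_zeta A)"

lemma (in finite_category) finite_factorizations: "finite (factorizations A f)"
proof (rule finite_subset)
  show "factorizations A f \<subseteq> arcs A \<times> arcs A"
    by (auto simp: factorizations_def)
qed (simp add: finite_maps)

lemma (in category) tail_in_verts: "f \<in> arcs A \<Longrightarrow> tail A f \<in> verts A"
  and head_in_verts: "f \<in> arcs A \<Longrightarrow> head A f \<in> verts A"
  using wf_underlying_digraph by (auto simp: wf_digraph_def underlying_digraph_def)

text \<open>In particular, inverses in the fine incidence algebra are unique.\<close>

lemma (in finite_category) monoid_fine_incidence_algebra: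
  "monoid (fine_incidence_algebra A ::
     ('k::{comm_semiring_0, comm_monoid_mult}, 'm \<Rightarrow> 'k) module)"
proof (rule monoidI; (simp add: fine_incidence_algebra_def)?)
  fix \<alpha> \<beta> \<gamma> :: "'m \<Rightarrow> 'k"
  let ?F = "factorizations A"
  show "(\<lambda>f\<in>arcs A. \<Sum>(g, h)\<in>?F f.
            (if g \<in> arcs A then \<Sum>(g', h')\<in>?F g. \<alpha> g' * \<beta> h' else undefined) * \<gamma> h) =
        (\<lambda>f\<in>arcs A. \<Sum>(g, h)\<in>?F f.
            \<alpha> g * (if h \<in> arcs A then \<Sum>(g', h')\<in>?F h. \<beta> g' * \<gamma> h' else undefined))"
  proof (rule restrict_ext)
    fix f
    have "(\<Sum>(g, h)\<in>?F f.
            (if g \<in> arcs A then \<Sum>(g', h')\<in>?F g. \<alpha> g' * \<beta> h' else undefined) * \<gamma> h) =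
          (\<Sum>p\<in>?F f. \<Sum>q\<in>?F (fst p). \<alpha> (fst q) * \<beta> (snd q) * \<gamma> (snd p))"
      by (rule sum.cong) (auto simp: factorizations_def sum_distrib_right split_beta)
    also have "\<dots> = (\<Sum>(p, q)\<in>Sigma (?F f) (\<lambda>p. ?F (fst p)). \<alpha> (fst q) * \<beta> (snd q) * \<gamma> (snd p))"
      by (rule sum.Sigma) (simp_all add: finite_factorizations)
    also have "\<dots> = (\<Sum>(p, q)\<in>Sigma (?F f) (\<lambda>p. ?F (snd p)). \<alpha> (fst p) * (\<beta> (fst q) * \<gamma> (snd q)))"
      by (rule sum.reindex_bij_witness
          [where i = "\<lambda>(p, q). ((cat_comp A (fst q) (fst p), snd q), (fst p, fst q))"
             and j = "\<lambda>(p, q). ((fst q, cat_comp A (snd p) (snd q)), (snd q, snd p))"])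
        (auto simp: factorizations_def comp_in_arcs tail_comp head_comp comp_assoc mult.assoc)
    also have "\<dots> = (\<Sum>p\<in>?F f. \<Sum>q\<in>?F (snd p). \<alpha> (fst p) * (\<beta> (fst q) * \<gamma> (snd q)))"
      by (rule sum.Sigma[symmetric]) (simp_all add: finite_factorizations)
    also have "\<dots> = (\<Sum>(g, h)\<in>?F f.
            \<alpha> g * (if h \<in> arcs A then \<Sum>(g', h')\<in>?F h. \<beta> g' * \<gamma> h' else undefined))"
      by (rule sum.cong) (auto simp: factorizations_def sum_distrib_left split_beta)
    finally show "(\<Sum>(g, h)\<in>?F f.
            (if g \<in> arcs A then \<Sum>(g', h')\<in>?F g. \<alpha> g' * \<beta> h' else undefined) * \<gamma> h) =
          (\<Sum>(g, h)\<in>?F f.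
            \<alpha> g * (if h \<in> arcs A then \<Sum>(g', h')\<in>?F h. \<beta> g' * \<gamma> h' else undefined))" .
  qed
next
  fix \<alpha> :: "'m \<Rightarrow> 'k" assume \<alpha>: "\<alpha> \<in> arcs A \<rightarrow>\<^sub>E UNIV"
  show "(\<lambda>f\<in>arcs A. \<Sum>(g, h)\<in>factorizations A f.
      (if g \<in> arcs A then if g \<in> cat_id A ` verts A then 1 else 0 else undefined) * \<alpha> h) = \<alpha>"
  proof (rule extensionalityI[of _ "arcs A"])
    fix f assume f: "f \<in> arcs A"
    have "(\<Sum>(g, h)\<in>factorizations A f.
       (if g \<in> arcs A then if g \<in> cat_id A ` verts A then 1 else 0 else undefined) * \<alpha> h) =
       (\<Sum>p\<in>{(cat_id A (tail A f), f)}. \<alpha> (snd p))"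
      using f
      by (intro sum.mono_neutral_cong_right finite_factorizations)
        (auto simp: factorizations_def id_in_arcs head_id tail_id comp_id_right tail_in_verts
          split: if_splits)
    then show "(\<lambda>f\<in>arcs A. \<Sum>(g, h)\<in>factorizations A f.
      (if g \<in> arcs A then if g \<in> cat_id A ` verts A then 1 else 0 else undefined) * \<alpha> h) f = \<alpha> f"
      using f by simp
  qed (use \<alpha> in \<open>auto simp: PiE_iff\<close>)
  show "(\<lambda>f\<in>arcs A. \<Sum>(g, h)\<in>factorizations A f.
      \<alpha> g * (if h \<in> arcs A then if h \<in> cat_id A ` verts A then 1 else 0 else undefined)) = \<alpha>"
  proof (rule extensionalityI[of _ "arcs A"])
    fix f assume f: "f \<in> arcs A"
    have "(\<Sum>(g, h)\<in>factorizations A f.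
       \<alpha> g * (if h \<in> arcs A then if h \<in> cat_id A ` verts A then 1 else 0 else undefined)) =
       (\<Sum>p\<in>{(f, cat_id A (head A f))}. \<alpha> (fst p))"
      using f
      by (intro sum.mono_neutral_cong_right finite_factorizations)
        (auto simp: factorizations_def id_in_arcs head_id tail_id comp_id_left head_in_verts
          dest: sym split: if_splits)
    then show "(\<lambda>f\<in>arcs A. \<Sum>(g, h)\<in>factorizations A f.
      \<alpha> g * (if h \<in> arcs A then if h \<in> cat_id A ` verts A then 1 else 0 else undefined)) f = \<alpha> f"
      using f by simp
  qed (use \<alpha> in \<open>auto simp: PiE_iff\<close>)
qed

end

theory Submission
  imports Defs
begin

text \<open>
  The composition law enters the inversion identities only through the factorizations of single
  maps, and it drops out on summing over all maps with a common end.  Summing \<open>\<mu> * \<zeta> = \<delta>\<close> over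
  the maps with target \<open>c\<close> gives, on the left, the sum of \<open>\<mu> g\<close> over all composable pairs
  \<open>(g, h)\<close> with \<open>h\<close> ending at \<open>c\<close>; on the right it gives \<open>1\<close>, contributed by the identity of \<open>c\<close>
  (\<open>sum_moebius_into\<close>; in Leinster's terms, the target sums of \<open>\<mu>\<close> form a coweighting).
  Dually, \<open>\<zeta> * \<mu> = \<delta>\<close> gives an identity for pairs that start at a given object
  (\<open>sum_moebius_out_of\<close>, a weighting).

  Apart from the values of \<open>\<mu>\<close>, these identities involve the underlying directed graph alone, so
  two categories on the same graph can supply one each.  Consider the sum of \<open>\<mu> g * \<mu>' f\<close> over
  all paths of three maps \<open>g\<close>, \<open>h\<close>, \<open>f\<close>, where \<open>\<mu>\<close> and \<open>\<mu>'\<close> are the two Moebius functions.  For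
  fixed \<open>f\<close>, the first identity shows that the pairs \<open>(g, h)\<close> contribute \<open>\<mu>' f\<close>; for fixed \<open>g\<close>,
  the second shows that the pairs \<open>(h, f)\<close> contribute \<open>\<mu> g\<close>.  Hence both totals equal the triple
  sum.  This is the argument that a left inverse of a matrix equals a right inverse, which is valid
  over any rig.
\<close>

context finite_category
begin

lemma sum_factorizations:
  fixes \<phi> :: "'m \<times> 'm \<Rightarrow> 'k::comm_monoid_add"
  assumes "F \<subseteq> arcs A"
  shows "(\<Sum>f\<in>F. \<Sum>p\<in>factorizations A f. \<phi> p) =
    (\<Sum>p\<in>{(g, h). g \<in> arcs A \<and> h \<in> arcs A \<and> head A g = tail A h \<and> cat_comp A h g \<in> F}. \<phi> p)"
    (is "_ = sum \<phi> ?P")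
proof -
  have finite_P: "finite ?P"
    by (rule finite_subset[of _ "arcs A \<times> arcs A"]) (auto simp: finite_maps)
  have "sum \<phi> ?P = (\<Sum>f\<in>F. \<Sum>p\<in>{p\<in>?P. (\<lambda>(g, h). cat_comp A h g) p = f}. \<phi> p)"
    by (rule sum.group[symmetric])
      (use assms finite_P in \<open>auto intro: finite_subset[OF _ finite_maps]\<close>)
  also have "\<dots> = (\<Sum>f\<in>F. \<Sum>p\<in>factorizations A f. \<phi> p)"
    by (intro sum.cong refl) (auto simp: factorizations_def)
  finally show ?thesis ..
qed

lemma
  assumes "has_fine_moebius_inversion TYPE('k::{comm_semiring_0, comm_monoid_mult}) A"
    and "f \<in> arcs A"
  shows sum_moebius_first: "(\<Sum>(g, h)\<in>factorizations A f. fine_moebius A g) =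
      (if f \<in> cat_id A ` verts A then 1 else 0 :: 'k)" (is ?first)
    and sum_moebius_second: "(\<Sum>(g, h)\<in>factorizations A f. fine_moebius A h) =
      (if f \<in> cat_id A ` verts A then 1 else 0 :: 'k)" (is ?second)
proof -
  let ?R = "fine_incidence_algebra A :: ('k, 'm \<Rightarrow> 'k) module"
  let ?\<mu> = "fine_moebius A :: 'm \<Rightarrow> 'k" and ?\<zeta> = "fine_zeta A :: 'm \<Rightarrow> 'k"
  interpret R: monoid ?R
    by (rule monoid_fine_incidence_algebra)
  have "?\<zeta> \<in> Units ?R"
    using assms(1) by (simp add: has_fine_moebius_inversion_def)
  then have inverse: "(?\<mu> \<otimes>\<^bsub>?R\<^esub> ?\<zeta>) f = \<one>\<^bsub>?R\<^esub> f" "(?\<zeta> \<otimes>\<^bsub>?R\<^esub> ?\<mu>) f = \<one>\<^bsub>?R\<^esub> f"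
    by (simp_all add: fine_moebius_def)
  have "(\<Sum>(g, h)\<in>factorizations A f. ?\<mu> g) = (?\<mu> \<otimes>\<^bsub>?R\<^esub> ?\<zeta>) f"
    using assms(2)
    by (auto simp: fine_incidence_algebra_def fine_zeta_def factorizations_def intro!: sum.cong)
  with inverse(1) assms(2) show ?first
    by (simp add: fine_incidence_algebra_def)
  have "(\<Sum>(g, h)\<in>factorizations A f. ?\<mu> h) = (?\<zeta> \<otimes>\<^bsub>?R\<^esub> ?\<mu>) f"
    using assms(2)
    by (auto simp: fine_incidence_algebra_def fine_zeta_def factorizations_def intro!: sum.cong)
  with inverse(2) assms(2) show ?second
    by (simp add: fine_incidence_algebra_def)
qed

lemma sum_delta_head:
  assumes "c \<in> verts A"
  shows "(\<Sum>f\<in>{f\<in>arcs A. head A f = c}. if f \<in> cat_id A ` verts A then 1 else 0) =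
    (1 :: 'k::{comm_semiring_0, comm_monoid_mult})"
proof -
  have "(\<Sum>f\<in>{f\<in>arcs A. head A f = c}. if f \<in> cat_id A ` verts A then 1 else 0) =
      (\<Sum>f\<in>{cat_id A c}. 1 :: 'k)"
    using assms
    by (intro sum.mono_neutral_cong_right) (auto simp: finite_maps id_in_arcs head_id)
  then show ?thesis by simp
qed

lemma sum_delta_tail:
  assumes "c \<in> verts A"
  shows "(\<Sum>f\<in>{f\<in>arcs A. tail A f = c}. if f \<in> cat_id A ` verts A then 1 else 0) =
    (1 :: 'k::{comm_semiring_0, comm_monoid_mult})"
proof -
  have "(\<Sum>f\<in>{f\<in>arcs A. tail A f = c}. if f \<in> cat_id A ` verts A then 1 else 0) =
      (\<Sum>f\<in>{cat_id A c}. 1 :: 'k)"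
    using assms
    by (intro sum.mono_neutral_cong_right) (auto simp: finite_maps id_in_arcs tail_id)
  then show ?thesis by simp
qed

text \<open>
  A composite ends where its second factor does, so the pairs below are exactly the
  factorizations of the maps into \<open>c\<close>, whichever map each pair composes to.
\<close>

lemma sum_moebius_into:
  assumes "has_fine_moebius_inversion TYPE('k::{comm_semiring_0, comm_monoid_mult}) A"
    and "c \<in> verts A"
  shows "(\<Sum>h\<in>{h\<in>arcs A. head A h = c}. \<Sum>g\<in>{g\<in>arcs A. head A g = tail A h}.
    fine_moebius A g) = (1 :: 'k)"
proof -
  let ?\<mu> = "fine_moebius A :: 'm \<Rightarrow> 'k"
  let ?F = "{f\<in>arcs A. head A f = c}"
  let ?P = "{(g, h). g \<in> arcs A \<and> h \<in> arcs A \<and> head A g = tail A h \<and> cat_comp A h g \<in> ?F}"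
  have "(\<Sum>h\<in>?F. \<Sum>g\<in>{g\<in>arcs A. head A g = tail A h}. ?\<mu> g) =
      (\<Sum>(h, g)\<in>(SIGMA h:?F. {g\<in>arcs A. head A g = tail A h}). ?\<mu> g)"
    by (rule sum.Sigma) (auto simp: finite_maps)
  also have "\<dots> = (\<Sum>(g, h)\<in>?P. ?\<mu> g)"
    by (rule sum.reindex_bij_witness[where i = prod.swap and j = prod.swap])
      (auto simp: comp_in_arcs head_comp)
  also have "\<dots> = (\<Sum>f\<in>?F. \<Sum>(g, h)\<in>factorizations A f. ?\<mu> g)"
    by (rule sum_factorizations[symmetric]) auto
  also have "\<dots> = (\<Sum>f\<in>?F. if f \<in> cat_id A ` verts A then 1 else 0)"
    by (intro sum.cong refl sum_moebius_first assms) simp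
  also have "\<dots> = 1"
    by (rule sum_delta_head) (rule assms)
  finally show ?thesis .
qed

text \<open>
  The dual argument: a composite starts where its first factor does.
\<close>

lemma sum_moebius_out_of:
  assumes "has_fine_moebius_inversion TYPE('k::{comm_semiring_0, comm_monoid_mult}) A"
    and "a \<in> verts A"
  shows "(\<Sum>h\<in>{h\<in>arcs A. tail A h = a}. \<Sum>f\<in>{f\<in>arcs A. tail A f = head A h}.
    fine_moebius A f) = (1 :: 'k)"
proof -
  let ?\<mu> = "fine_moebius A :: 'm \<Rightarrow> 'k"
  let ?F = "{f\<in>arcs A. tail A f = a}"
  let ?P = "{(g, h). g \<in> arcs A \<and> h \<in> arcs A \<and> head A g = tail A h \<and> cat_comp A h g \<in> ?F}"
  have "(\<Sum>h\<in>?F. \<Sum>f\<in>{f\<in>arcs A. tail A f = head A h}. ?\<mu> f) =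
      (\<Sum>(h, f)\<in>(SIGMA h:?F. {f\<in>arcs A. tail A f = head A h}). ?\<mu> f)"
    by (rule sum.Sigma) (auto simp: finite_maps)
  also have "\<dots> = (\<Sum>(h, f)\<in>?P. ?\<mu> f)"
    by (rule sum.cong) (auto simp: comp_in_arcs tail_comp)
  also have "\<dots> = (\<Sum>f\<in>?F. \<Sum>(g, h)\<in>factorizations A f. ?\<mu> h)"
    by (rule sum_factorizations[symmetric]) auto
  also have "\<dots> = (\<Sum>f\<in>?F. if f \<in> cat_id A ` verts A then 1 else 0)"
    by (intro sum.cong refl sum_moebius_second assms) simp
  also have "\<dots> = 1"
    by (rule sum_delta_tail) (rule assms)
  finally show ?thesis .
qed

end

theorem corollary1p8:
  fixes A A' :: "('o, 'm) cat"
  assumes "finite_category A" and "finite_category A'"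
    and "has_fine_moebius_inversion TYPE('k::{comm_semiring_0, comm_monoid_mult}) A"
    and "has_fine_moebius_inversion TYPE('k) A'"
    and "underlying_digraph A = underlying_digraph A'"
  shows "(\<Sum>f\<in>arcs A. fine_moebius A f) = (\<Sum>f\<in>arcs A'. fine_moebius A' f :: 'k)"
proof -
  interpret A: finite_category A by (rule assms(1))
  interpret A': finite_category A' by (rule assms(2))
  let ?\<mu> = "fine_moebius A :: 'm \<Rightarrow> 'k" and ?\<mu>' = "fine_moebius A' :: 'm \<Rightarrow> 'k"
  let ?E = "arcs A" and ?s = "tail A" and ?t = "head A"
  have verts: "verts A' = verts A" and arcs: "arcs A' = ?E"
    and restricted: "restrict (tail A') (arcs A') = restrict ?s ?E"
      "restrict (head A') (arcs A') = restrict ?t ?E"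
    using assms(5)[THEN arg_cong, of verts] assms(5)[THEN arg_cong, of arcs]
      assms(5)[THEN arg_cong, of tail] assms(5)[THEN arg_cong, of head]
    by (simp_all add: underlying_digraph_def)
  have ends: "tail A' f = ?s f" "head A' f = ?t f" if "f \<in> ?E" for f
    using restricted[THEN fun_cong, of f] that by (simp_all add: arcs)
  note finite_E = A.finite_maps
  have into: "(\<Sum>h\<in>{h\<in>?E. ?s f = ?t h}. \<Sum>g\<in>{g\<in>?E. ?s h = ?t g}. ?\<mu> g) = 1"
    if "f \<in> ?E" for f
    using A.sum_moebius_into[OF assms(3) A.tail_in_verts[OF that]] by (simp add: eq_commute[of "?s f"] eq_commute[of "?s h" for h])
  have out_of: "(\<Sum>h\<in>{h\<in>?E. ?s h = ?t g}. \<Sum>f\<in>{f\<in>?E. ?s f = ?t h}. ?\<mu>' f) = 1"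
    if "g \<in> ?E" for g
  proof -
    have "(\<Sum>h\<in>{h\<in>?E. ?s h = ?t g}. \<Sum>f\<in>{f\<in>?E. ?s f = ?t h}. ?\<mu>' f) =
        (\<Sum>h\<in>{h\<in>arcs A'. tail A' h = ?t g}. \<Sum>f\<in>{f\<in>arcs A'. tail A' f = head A' h}. ?\<mu>' f)"
      by (intro sum.cong) (auto simp: arcs ends)
    also have "\<dots> = 1"
      using that by (intro A'.sum_moebius_out_of assms) (simp add: verts A.head_in_verts)
    finally show ?thesis .
  qed
  have "(\<Sum>g\<in>?E. ?\<mu> g) =
      (\<Sum>g\<in>?E. \<Sum>h\<in>{h\<in>?E. ?s h = ?t g}. \<Sum>f\<in>{f\<in>?E. ?s f = ?t h}. ?\<mu> g * ?\<mu>' f)"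
    by (intro sum.cong refl) (simp add: out_of flip: sum_distrib_left)
  also have "\<dots> = (\<Sum>h\<in>?E. \<Sum>g\<in>{g\<in>?E. ?s h = ?t g}. \<Sum>f\<in>{f\<in>?E. ?s f = ?t h}. ?\<mu> g * ?\<mu>' f)"
    by (rule sum.swap_restrict) (rule finite_E)+
  also have "\<dots> = (\<Sum>h\<in>?E. \<Sum>f\<in>{f\<in>?E. ?s f = ?t h}. \<Sum>g\<in>{g\<in>?E. ?s h = ?t g}. ?\<mu> g * ?\<mu>' f)"
    by (intro sum.cong refl sum.swap)
  also have "\<dots> = (\<Sum>f\<in>?E. \<Sum>h\<in>{h\<in>?E. ?s f = ?t h}. \<Sum>g\<in>{g\<in>?E. ?s h = ?t g}. ?\<mu> g * ?\<mu>' f)"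
    by (rule sum.swap_restrict) (rule finite_E)+
  also have "\<dots> = (\<Sum>f\<in>?E. ?\<mu>' f)"
    by (intro sum.cong refl) (simp add: into flip: sum_distrib_right)
  finally show ?thesis
    by (simp add: arcs)
qed

end
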